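(* For every integer $k>2$, $\mathfrak{t}_{\mathcal{E}_k}=\mathfrak{p}_{\mathcal{E}_k}=\omega_1$, where $\mathcal{E}_k$ is considered with the quasi-order $\subseteq^{\mathrm{Fin}^{\otimes k}}$.
   Context: For $k\ge2$, $\omega^{\not\downarrow\le k}$ is the set of non-decreasing sequences of natural numbers of length $\le k$, and $\omega^{\not\downarrow k}$ those of length exactly $k$. Lexicographic order: $(s_0,\dots,s_i)<_{\mathrm{lex}}(t_0,\dots,t_j)$ iff there is $m\le\min(i,j)$ with $s_n=t_n$ for $n<m$ and either $s_m<t_m$, or $m=i<j$ and $s_i=t_i$. Well-order $\prec$: the empty sequence is $\prec$-least, and for nonempty sequences $(s_0,\dots,s_i)\prec(t_0,\dots,t_j)$ iff $s_i<t_j$, or $s_i=t_j$ and $(s_0,\dots,s_i)<_{\mathrm{lex}}(t_0,\dots,t_j)$. An $\mathcal{E}_k$-tree is a function $\widehat{X}:\omega^{\not\downarrow\le k}\to\omega^{\not\downarrow\le k}$ preserving $\prec$ and the proper-initial-segment relation. $\mathcal{E}_k$ is the set of (ranges of) restrictions $X=\widehat{X}\restriction\omega^{\not\downarrow k}$ for $\mathcal{E}_k$-trees $\widehat{X}$; each $X\in\mathcal{E}_k$ is a subset of $\omega^k$. $\mathrm{Fin}^{\otimes1}$ is the ideal of finite subsets of $\omega$; $\mathrm{Fin}^{\otimes(k+1)}$ is the ideal of $I\subseteq\omega^{k+1}$ such that for all but finitely many $n$, $\{(j_1,\dots,j_k):(n,j_1,\dots,j_k)\in I\}\in\mathrm{Fin}^{\otimes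 k}$. $X\subseteq^{\mathrm{Fin}^{\otimes k}}Y$ iff $X\setminus Y\in\mathrm{Fin}^{\otimes k}$. With $\le^*$ the quasi-order $\subseteq^{\mathrm{Fin}^{\otimes k}}$ on $\mathcal{E}_k$: a pseudointersection of $\mathcal{F}\subseteq\mathcal{E}_k$ is $Y\in\mathcal{E}_k$ with $Y\le^*X$ for all $X\in\mathcal{F}$; $\mathcal{F}$ has the SFIP if every finite subfamily has a common $\le^*$-lower bound in $\mathcal{E}_k$; $\mathfrak{p}_{\mathcal{E}_k}$ is the least size of a family with the SFIP and no pseudointersection; $\mathfrak{t}_{\mathcal{E}_k}$ is the least size of a family linearly ordered by $\ge^*$ with no pseudointersection. *)

theory Defs
  imports Main "HOL-Library.Sublist"
begin

unbundle cardinal_syntax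

text \<open>Finite sequences are lists; the subsets of \<open>\<omega>\<^sup>k\<close> are sets of lists of length \<open>k\<close>.\<close>

definition nondec_le :: "nat \<Rightarrow> nat list set" where
  "nondec_le k = {s. sorted s \<and> length s \<le> k}"

definition nondec_eq :: "nat \<Rightarrow> nat list set" where
  "nondec_eq k = {s. sorted s \<and> length s = k}"

definition lex_less :: "nat list \<Rightarrow> nat list \<Rightarrow> bool" where
  "lex_less s t \<longleftrightarrow>
     (\<exists>m. m < length s \<and> m < length t \<and> (\<forall>n<m. s ! n = t ! n) \<and>
        (s ! m < t ! m \<or> (m = length s - 1 \<and> length s < length t \<and> s ! m = t ! m)))"

definition seq_prec :: "nat list \<Rightarrow> nat list \<Rightarrow> bool" where
  "seq_prec s t \<longleftrightarrow>
     (if s = [] then t \<noteq> []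
      else t \<noteq> [] \<and> (last s < last t \<or> (last s = last t \<and> lex_less s t)))"

definition E_tree :: "nat \<Rightarrow> (nat list \<Rightarrow> nat list) \<Rightarrow> bool" where
  "E_tree k f \<longleftrightarrow>
     f ` nondec_le k \<subseteq> nondec_le k \<and>
     (\<forall>s\<in>nondec_le k. \<forall>t\<in>nondec_le k. seq_prec s t \<longrightarrow> seq_prec (f s) (f t)) \<and>
     (\<forall>s\<in>nondec_le k. \<forall>t\<in>nondec_le k. strict_prefix s t \<longrightarrow> strict_prefix (f s) (f t))"

definition E_space :: "nat \<Rightarrow> nat list set set" where
  "E_space k = {f ` nondec_eq k |f. E_tree k f}"

text \<open>The tensor power is only meant for exponents \<open>\<ge> 1\<close>; the value at \<open>0\<close> is a dummy.\<close>

fun Fin_tensor :: "nat \<Rightarrow> nat list set set" where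
  "Fin_tensor 0 = {{}}"
| "Fin_tensor (Suc 0) = {I. (\<forall>s\<in>I. length s = 1) \<and> finite I}"
| "Fin_tensor (Suc (Suc k)) =
     {I. (\<forall>s\<in>I. length s = Suc (Suc k)) \<and>
         (\<forall>\<^sub>\<infinity>n. {js. n # js \<in> I} \<in> Fin_tensor (Suc k))}"

definition almost_subset :: "nat \<Rightarrow> nat list set \<Rightarrow> nat list set \<Rightarrow> bool" where
  "almost_subset k X Y \<longleftrightarrow> X - Y \<in> Fin_tensor k"

definition pseudointersection :: "nat \<Rightarrow> nat list set set \<Rightarrow> nat list set \<Rightarrow> bool" where
  "pseudointersection k F Y \<longleftrightarrow> Y \<in> E_space k \<and> (\<forall>X\<in>F. almost_subset k Y X)"

definition SFIP :: "nat \<Rightarrow> nat list set set \<Rightarrow> bool" where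
  "SFIP k F \<longleftrightarrow>
     (\<forall>G. G \<subseteq> F \<and> finite G \<longrightarrow> (\<exists>Y\<in>E_space k. \<forall>X\<in>G. almost_subset k Y X))"

definition p_families :: "nat \<Rightarrow> nat list set set set" where
  "p_families k = {F. F \<subseteq> E_space k \<and> SFIP k F \<and> \<not> (\<exists>Y. pseudointersection k F Y)}"

text \<open>\<open>almost_subset\<close> is only a quasi-order, so linearity means that any two members are comparable;
  no antisymmetry is required.\<close>

definition t_families :: "nat \<Rightarrow> nat list set set set" where
  "t_families k = {F. F \<subseteq> E_space k \<and>
     (\<forall>X\<in>F. \<forall>Y\<in>F. almost_subset k Y X \<or> almost_subset k X Y) \<and>
     \<not> (\<exists>Y. pseudointersection k F Y)}"

text \<open>Cardinals are cardinal-order relations, identified up to \<open>=o\<close>. Stating \<open>is_least_size\<close> as a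
  relation makes the existence of a member of the class part of the assertion, so no default
  value for an empty class is involved.\<close>

definition is_least_size :: "'a set set \<Rightarrow> 'b rel \<Rightarrow> bool" where
  "is_least_size \<C> \<kappa> \<longleftrightarrow> (\<exists>F\<in>\<C>. |F| =o \<kappa>) \<and> (\<forall>F\<in>\<C>. \<kappa> \<le>o |F| )"

definition is_p_number :: "nat \<Rightarrow> 'b rel \<Rightarrow> bool" where
  "is_p_number k \<kappa> \<longleftrightarrow> is_least_size (p_families k) \<kappa>"

definition is_t_number :: "nat \<Rightarrow> 'b rel \<Rightarrow> bool" where
  "is_t_number k \<kappa> \<longleftrightarrow> is_least_size (t_families k) \<kappa>"

abbreviation omega1 :: "nat set rel" where
  "omega1 \<equiv> cardSuc natLeq"

end

theory Submission
  imports Defs "HOL-Library.Countable_Set_Type"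
begin

text \<open>Call a set positive if it is not in \<open>Fin_tensor k\<close>. Members of \<open>E_space k\<close> are positive, and every
  positive set of non-decreasing sequences contains a member of \<open>E_space k\<close>: the tree is built along
  the well-order, always taking the next entry larger than everything used before. So one may work
  with positive sets and thin out to a member of \<open>E_space k\<close> at the end.

  Countable families with the SFIP are diagonalised by gluing fibers over distinct first
  coordinates. For the upper bound, a decreasing tower \<open>X\<^sub>a\<close>, \<open>a < \<omega>\<^sub>1\<close>, is built so that for every \<open>n\<close>
  and \<open>a\<close>, only finitely many \<open>b < a\<close> have \<open>fiber X\<^sub>a n \<inter> fiber X\<^sub>b n\<close> positive. If \<open>Y\<close> were a
  pseudointersection, then for each \<open>a\<close> the fibers of \<open>Y\<close> beyond some \<open>m\<close> would be almost contained
  in those of \<open>X\<^sub>a\<close>; one \<open>m\<close> serves uncountably many \<open>a\<close>, and a positive fiber of \<open>Y\<close> beyond it gives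
  an \<open>a\<close> with infinitely many \<open>b < a\<close> of the excluded kind.\<close>

subsection \<open>The ideals and their positive sets\<close>

definition fiber :: "nat list set \<Rightarrow> nat \<Rightarrow> nat list set" where
  "fiber A n = {js. n # js \<in> A}"

lemma fiber_simps [simp]:
  "fiber (A \<union> B) n = fiber A n \<union> fiber B n"
  "fiber (A \<inter> B) n = fiber A n \<inter> fiber B n"
  "fiber (A - B) n = fiber A n - fiber B n"
  "js \<in> fiber A n \<longleftrightarrow> n # js \<in> A"
  by (auto simp: fiber_def)

lemma fiber_mono: "A \<subseteq> B \<Longrightarrow> fiber A n \<subseteq> fiber B n"
  by (auto simp: fiber_def)

text \<open>The dummy value \<open>{{}}\<close> at exponent 0 makes the recursion uniform: a fiber
  of a set of lists of length one is \<open>{}\<close> or \<open>{[]}\<close>, and only the former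
  lies in \<open>Fin_tensor 0\<close>. Inductions can therefore start at 0.\<close>

lemma Fin_tensor_Suc:
  "I \<in> Fin_tensor (Suc k) \<longleftrightarrow>
     (\<forall>s\<in>I. length s = Suc k) \<and> (\<forall>\<^sub>\<infinity>n. fiber I n \<in> Fin_tensor k)"
proof (cases k)
  case 0
  have "finite I \<longleftrightarrow> finite {n. fiber I n \<noteq> {}}" if len: "\<forall>s\<in>I. length s = 1"
  proof -
    have I: "I = (\<lambda>n. [n]) ` {n. [n] \<in> I}"
      using len by (auto simp: length_Suc_conv)
    have "finite I \<longleftrightarrow> finite {n. [n] \<in> I}"
      by (subst I, subst finite_image_iff) (auto simp: inj_on_def)
    also have "{n. [n] \<in> I} = {n. fiber I n \<noteq> {}}"
      using len by (auto simp: fiber_def length_Suc_conv) 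
    finally show ?thesis .
  qed
  then show ?thesis
    using 0 by (auto simp: eventually_cofinite)
next
  case (Suc m)
  then show ?thesis
    by (simp add: fiber_def)
qed

lemma Fin_tensor_empty [simp]: "{} \<in> Fin_tensor k"
  by (induction k) (auto simp: Fin_tensor_Suc fiber_def)

lemma Fin_tensor_subset: "I \<in> Fin_tensor k \<Longrightarrow> J \<subseteq> I \<Longrightarrow> J \<in> Fin_tensor k"
proof (induction k arbitrary: I J)
  case (Suc k)
  have "\<forall>\<^sub>\<infinity>n. fiber I n \<in> Fin_tensor k"
    using Suc.prems by (simp add: Fin_tensor_Suc)
  then have "\<forall>\<^sub>\<infinity>n. fiber J n \<in> Fin_tensor k"
    by (rule eventually_mono) (use Suc.IH fiber_mono[OF Suc.prems(2)] in blast)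
  then show ?case
    using Suc.prems by (auto simp: Fin_tensor_Suc)
qed auto

lemma Fin_tensor_Un:
  "I \<in> Fin_tensor k \<Longrightarrow> J \<in> Fin_tensor k \<Longrightarrow> I \<union> J \<in> Fin_tensor k"
proof (induction k arbitrary: I J)
  case (Suc k)
  have "\<forall>\<^sub>\<infinity>n. fiber I n \<in> Fin_tensor k \<and> fiber J n \<in> Fin_tensor k"
    using Suc.prems by (simp add: Fin_tensor_Suc eventually_conj_iff)
  then have "\<forall>\<^sub>\<infinity>n. fiber (I \<union> J) n \<in> Fin_tensor k"
    by (rule eventually_mono) (use Suc.IH in auto)
  then show ?case
    using Suc.prems by (auto simp: Fin_tensor_Suc)
qed auto

lemma Fin_tensor_cover:
  "I \<in> Fin_tensor k \<Longrightarrow> J \<in> Fin_tensor k \<Longrightarrow> A \<subseteq> I \<union> J \<Longrightarrow> A \<in> Fin_tensor k"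
  by (blast intro: Fin_tensor_subset Fin_tensor_Un)

lemma Fin_tensor_UN:
  "finite G \<Longrightarrow> (\<And>x. x \<in> G \<Longrightarrow> A x \<in> Fin_tensor k) \<Longrightarrow> (\<Union>x\<in>G. A x) \<in> Fin_tensor k"
  by (induction G rule: finite_induct) (auto intro: Fin_tensor_Un)

lemma positive_iff_fibers:
  assumes "\<forall>s\<in>A. length s = Suc k"
  shows "A \<notin> Fin_tensor (Suc k) \<longleftrightarrow> infinite {n. fiber A n \<notin> Fin_tensor k}"
  using assms by (simp add: Fin_tensor_Suc eventually_cofinite)

lemma almost_subset_refl: "almost_subset k X X"
  by (simp add: almost_subset_def)

lemma almost_subset_trans:
  "almost_subset k X Y \<Longrightarrow> almost_subset k Y Z \<Longrightarrow> almost_subset k X Z"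
  unfolding almost_subset_def by (erule Fin_tensor_cover) auto

lemma almost_subset_fibers:
  assumes "almost_subset (Suc k) X Y"
  shows "finite {n. fiber X n - fiber Y n \<notin> Fin_tensor k}"
  using assms by (simp add: almost_subset_def Fin_tensor_Suc eventually_cofinite)

section \<open>Gluing and diagonalising along first coordinates\<close>

lemma strict_mono_choice:
  fixes Q :: "nat \<Rightarrow> nat \<Rightarrow> bool"
  assumes "\<And>i. infinite {n. Q i n}"
  obtains h where "strict_mono h" "\<And>i. Q i (h i)"
proof -
  have ex: "\<exists>n>m. Q i n" for i m
    using assms[of i] unfolding infinite_nat_iff_unbounded by auto
  obtain h where "\<And>i. Q i (h i)" "\<And>i. h i < h (Suc i)"
    using dependent_nat_choice[of Q "\<lambda>i m n. m < n"] ex by metis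
  then show thesis
    using that strict_mono_Suc_iff by blast
qed

definition glue :: "(nat \<Rightarrow> nat) \<Rightarrow> (nat \<Rightarrow> nat list set) \<Rightarrow> nat list set" where
  "glue h B = (\<Union>i. (#) (h i) ` B i)"

lemma fiber_glue: "strict_mono h \<Longrightarrow> fiber (glue h B) (h i) = B i"
  by (auto simp: glue_def fiber_def strict_mono_eq)

lemma fiber_glue_outside: "n \<notin> range h \<Longrightarrow> fiber (glue h B) n = {}"
  by (auto simp: glue_def fiber_def)

lemma glue_positive:
  assumes "strict_mono h" "\<And>i. B i \<notin> Fin_tensor k"
  shows "glue h B \<notin> Fin_tensor (Suc k)"
proof
  assume "glue h B \<in> Fin_tensor (Suc k)"
  then have "finite {n. fiber (glue h B) n \<notin> Fin_tensor k}"
    by (simp add: Fin_tensor_Suc eventually_cofinite)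
  moreover have "range h \<subseteq> {n. fiber (glue h B) n \<notin> Fin_tensor k}"
    using assms by (auto simp: fiber_glue)
  moreover have "infinite (range h)"
    using assms(1) by (simp add: range_inj_infinite strict_mono_imp_inj_on)
  ultimately show False
    using finite_subset by blast
qed

lemma glue_almost_subset:
  assumes h: "strict_mono h"
    and len: "\<And>i s. s \<in> B i \<Longrightarrow> length s = k"
    and sub: "\<And>i. j \<le> i \<Longrightarrow> B i - fiber X (h i) \<in> Fin_tensor k"
  shows "almost_subset (Suc k) (glue h B) X"
proof -
  have "{n. fiber (glue h B - X) n \<notin> Fin_tensor k} \<subseteq> h ` {..<j}"
  proof
    fix n assume "n \<in> {n. fiber (glue h B - X) n \<notin> Fin_tensor k}"
    then have n: "fiber (glue h B) n - fiber X n \<notin> Fin_tensor k" by simp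
    then obtain i where i: "n = h i"
      by (metis Diff_eq_empty_iff Fin_tensor_empty empty_subsetI fiber_glue_outside rangeE)
    with n have "\<not> j \<le> i"
      using sub h by (auto simp: fiber_glue)
    with i show "n \<in> h ` {..<j}" by auto
  qed
  then have "finite {n. fiber (glue h B - X) n \<notin> Fin_tensor k}"
    by (rule finite_subset) simp
  moreover have "\<forall>s\<in>glue h B - X. length s = Suc k"
    using len by (auto simp: glue_def)
  ultimately show ?thesis
    by (simp add: almost_subset_def Fin_tensor_Suc eventually_cofinite)
qed

text \<open>Positivity gives infinitely many positive fibers, and each of the finitely many
  almost-inclusions fails on only finitely many of them.\<close>

lemma infinitely_many_good_fibers:
  fixes i :: nat
  assumes len: "\<And>s. s \<in> Y \<Longrightarrow> length s = Suc k"
    and pos: "Y \<notin> Fin_tensor (Suc k)"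
    and sub: "\<And>j. j \<le> i \<Longrightarrow> almost_subset (Suc k) Y (X j)"
  shows "infinite {n. fiber Y n \<notin> Fin_tensor k \<and>
    (\<forall>j\<le>i. fiber Y n - fiber (X j) n \<in> Fin_tensor k)}" (is "infinite {n. ?Q n}")
proof -
  have "{n. fiber Y n \<notin> Fin_tensor k} - {n. ?Q n}
      \<subseteq> (\<Union>j\<le>i. {n. fiber Y n - fiber (X j) n \<notin> Fin_tensor k})"
    by auto
  moreover have "finite \<dots>"
    by (intro finite_UN_I almost_subset_fibers sub) auto
  moreover have "infinite {n. fiber Y n \<notin> Fin_tensor k}"
    using positive_iff_fibers len pos by blast
  ultimately show ?thesis
    by (meson finite_Diff2 finite_subset)
qed

text \<open>One fiber is taken from each \<open>Y i\<close>, at a first coordinate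
  \<open>h i\<close> good for all \<open>X j\<close> with \<open>j \<le> i\<close>. For a fixed
  \<open>j\<close>, only the fibers with \<open>i < j\<close> can then be bad.\<close>

lemma positive_diagonal:
  fixes X Y :: "nat \<Rightarrow> nat list set"
  assumes len: "\<And>i s. s \<in> Y i \<Longrightarrow> length s = Suc k"
    and pos: "\<And>i. Y i \<notin> Fin_tensor (Suc k)"
    and sub: "\<And>i j. j \<le> i \<Longrightarrow> almost_subset (Suc k) (Y i) (X j)"
  shows "\<exists>A \<subseteq> (\<Union>i. Y i). A \<notin> Fin_tensor (Suc k) \<and> (\<forall>j. almost_subset (Suc k) A (X j))"
proof -
  let ?Q = "\<lambda>i n. fiber (Y i) n \<notin> Fin_tensor k \<and>
    (\<forall>j\<le>i. fiber (Y i) n - fiber (X j) n \<in> Fin_tensor k)"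
  have "infinite {n. ?Q i n}" for i
    using len pos sub by (rule infinitely_many_good_fibers)
  then obtain h where h: "strict_mono h" and Q: "\<And>i. ?Q i (h i)"
    using strict_mono_choice[of ?Q] by blast
  let ?A = "glue h (\<lambda>i. fiber (Y i) (h i))"
  show ?thesis
  proof (intro exI[of _ ?A] conjI allI)
    show "?A \<subseteq> (\<Union>i. Y i)" by (auto simp: glue_def)
    show "?A \<notin> Fin_tensor (Suc k)" using h Q by (simp add: glue_positive)
    fix j
    show "almost_subset (Suc k) ?A (X j)"
      using h Q len by (intro glue_almost_subset[where j = j]) force+
  qed
qed

lemma positive_split:
  assumes len: "\<And>s. s \<in> A \<Longrightarrow> length s = Suc k" and pos: "A \<notin> Fin_tensor (Suc k)"
  shows "\<exists>B \<subseteq> A. B \<notin> Fin_tensor (Suc k) \<and> A - B \<notin> Fin_tensor (Suc k)"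
proof -
  have "infinite {n. fiber A n \<notin> Fin_tensor k}"
    using positive_iff_fibers len pos by blast
  then obtain h where h: "strict_mono h" and pos_h: "\<And>i::nat. fiber A (h i) \<notin> Fin_tensor k"
    using strict_mono_choice[of "\<lambda>_ n. fiber A n \<notin> Fin_tensor k"] by blast
  \<comment> \<open>\<open>C 0\<close> collects the fibers at even indices and \<open>C 1\<close>
    those at odd indices; both are positive, and \<open>C 1\<close> lies in
    \<open>A - C 0\<close>.\<close>
  define C where "C c = glue (\<lambda>i. h (2 * i + c)) (\<lambda>i. fiber A (h (2 * i + c)))" for c
  have "C c \<notin> Fin_tensor (Suc k)" for c
    unfolding C_def using h pos_h
    by (intro glue_positive) (auto simp: strict_mono_def)
  moreover have "C c \<subseteq> A" for c
    by (auto simp: C_def glue_def)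
  moreover have "C 1 \<inter> C 0 = {}"
  proof -
    have "2 * i + 1 \<noteq> 2 * j" for i j :: nat by presburger
    then show ?thesis
      using strict_mono_eq[OF h] by (fastforce simp: C_def glue_def)
  qed
  ultimately show ?thesis
    using Fin_tensor_subset[of "A - C 0" "Suc k" "C 1"] by (intro exI[of _ "C 0"]) blast
qed


subsection \<open>Trees and positive sets\<close>

lemma lex_less_irrefl: "\<not> lex_less s s"
  by (auto simp: lex_less_def)

lemma lex_less_trans:
  assumes "lex_less s t" "lex_less t u"
  shows "lex_less s u"
proof -
  obtain m where m: "m < length s" "m < length t" "\<forall>n<m. s ! n = t ! n"
    "s ! m < t ! m \<or> (m = length s - 1 \<and> length s < length t \<and> s ! m = t ! m)"
    using assms(1) by (auto simp: lex_less_def)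
  obtain l where l: "l < length t" "l < length u" "\<forall>n<l. t ! n = u ! n"
    "t ! l < u ! l \<or> (l = length t - 1 \<and> length t < length u \<and> t ! l = u ! l)"
    using assms(2) by (auto simp: lex_less_def)
  have eq: "\<forall>n<min m l. s ! n = u ! n"
    using m(3) l(3) by (metis min_less_iff_conj)
  consider "m < l" | "m = l" | "l < m" by linarith
  then show ?thesis
  proof cases
    case 1
    then have "t ! m = u ! m" using l(3) by blast
    with 1 m(1,4) l(1,2) eq show ?thesis
      unfolding lex_less_def by (intro exI[of _ m]) (simp; linarith)
  next
    case 2
    with m(1,4) l(1,2,4) eq show ?thesis
      unfolding lex_less_def by (intro exI[of _ m]) (simp; linarith)
  next
    case 3
    then have "s ! l = t ! l" using m(3) by blast
    with 3 m(1,2) l(1,2,4) eq show ?thesis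
      unfolding lex_less_def by (intro exI[of _ l]) (simp; linarith)
  qed
qed

lemma seq_prec_irrefl: "\<not> seq_prec s s"
  by (auto simp: seq_prec_def lex_less_irrefl)

lemma seq_prec_trans: "seq_prec s t \<Longrightarrow> seq_prec t u \<Longrightarrow> seq_prec s u"
  by (auto simp: seq_prec_def split: if_splits intro: lex_less_trans)

lemma nondec_le_bounded: "s \<in> nondec_le k \<Longrightarrow> x \<in> set s \<Longrightarrow> x \<le> last s"
  by (cases s rule: rev_cases) (auto simp: nondec_le_def sorted_append)

lemma finite_predecessors: "finite {t \<in> nondec_le k. seq_prec t s}"
proof (rule finite_subset)
  show "{t \<in> nondec_le k. seq_prec t s} \<subseteq> {t. set t \<subseteq> {..last s} \<and> length t \<le> k}"
  proof (intro subsetI CollectI conjI)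
    fix t x assume t: "t \<in> {t \<in> nondec_le k. seq_prec t s}" and "x \<in> set t"
    then have "x \<le> last t" "last t \<le> last s"
      using nondec_le_bounded by (auto simp: seq_prec_def split: if_splits)
    then show "x \<in> {..last s}" by simp
  qed (auto simp: nondec_le_def)
qed (simp add: finite_lists_length_le)

text \<open>Predecessor sets are finite, because their entries are bounded by \<open>last s\<close>,
  and they grow strictly along \<open>seq_prec\<close>; their cardinality is a measure.\<close>

lemma wf_seq_prec: "wf {(t, s). t \<in> nondec_le k \<and> s \<in> nondec_le k \<and> seq_prec t s}" (is "wf ?R")
proof (rule wf_subset)
  let ?pred = "\<lambda>s. {t \<in> nondec_le k. seq_prec t s}"
  show "wf (measure (\<lambda>s. card (?pred s)))" by simp
  have "?pred t \<subset> ?pred s" if "t \<in> nondec_le k" "seq_prec t s" for t s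
    using that seq_prec_irrefl seq_prec_trans by blast
  then show "?R \<subseteq> measure (\<lambda>s. card (?pred s))"
    using psubset_card_mono[OF finite_predecessors] by fastforce
qed

lemma seq_prec_butlast:
  assumes "s \<in> nondec_le k" "s \<noteq> []"
  shows "seq_prec (butlast s) s"
proof (cases "butlast s = []")
  case False
  obtain t x where s: "s = t @ [x]"
    using assms(2) by (cases s rule: rev_cases) auto
  with False have t: "t \<noteq> []" by auto
  have "last t \<le> x"
    using assms(1) t unfolding s nondec_le_def by (simp add: sorted_append)
  moreover have "lex_less t (t @ [x])"
    unfolding lex_less_def by (rule exI[of _ "length t - 1"]) (use t in \<open>auto simp: nth_append\<close>)
  ultimately show ?thesis
    using s t by (auto simp: seq_prec_def)
qed (use assms in \<open>simp add: seq_prec_def\<close>)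

lemma butlast_nondec_le: "s \<in> nondec_le k \<Longrightarrow> butlast s \<in> nondec_le k"
  by (auto simp: nondec_le_def sorted_butlast)

lemma snoc_nondec_le:
  assumes "s \<in> nondec_le k" "length s < k" "s = [] \<or> last s \<le> n"
  shows "s @ [n] \<in> nondec_le k"
  using assms nondec_le_bounded[OF assms(1)]
  by (force simp: nondec_le_def sorted_append)

section \<open>Members of \<open>E_space\<close> are positive\<close>

lemma nondec_eq_subset: "nondec_eq k \<subseteq> nondec_le k"
  by (auto simp: nondec_eq_def nondec_le_def)

text \<open>Each proper extension of \<open>s\<close> lengthens the image by at least one. Counting
  up from the empty sequence gives one inequality; extending \<open>s\<close> to length
  \<open>k\<close>, where images still have length at most \<open>k\<close>, gives the
  other.\<close>

lemma E_tree_length: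
  assumes f: "E_tree k f" and s: "s \<in> nondec_le k"
  shows "length (f s) = length s"
proof (rule antisym)
  have prefix: "length (f t) < length (f u)"
    if "t \<in> nondec_le k" "u \<in> nondec_le k" "strict_prefix t u" for t u
    using f that by (auto simp: E_tree_def intro: prefix_length_less)
  show "length s \<le> length (f s)"
    using s
  proof (induction s rule: rev_induct)
    case (snoc x s)
    then have "s \<in> nondec_le k" using butlast_nondec_le by fastforce
    then have "length s < length (f (s @ [x]))"
      using snoc prefix[of s "s @ [x]"] by (fastforce simp: strict_prefix_def)
    then show ?case by simp
  qed simp
  show "length (f s) \<le> length s"
    using s
  proof (induction "k - length s" arbitrary: s)
    case 0
    then have "f s \<in> nondec_le k" using f by (auto simp: E_tree_def)
    with 0 show ?case by (auto simp: nondec_le_def)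
  next
    case (Suc d)
    \<comment> \<open>Repeating the last entry is an extension that stays non-decreasing.\<close>
    let ?t = "s @ [if s = [] then 0 else last s]"
    have t: "?t \<in> nondec_le k"
      using Suc by (intro snoc_nondec_le) auto
    have "length (f ?t) \<le> length ?t"
      using Suc by (intro Suc.hyps(1)[OF _ t]) auto
    with prefix[OF Suc.prems t] show ?case by (auto simp: strict_prefix_def)
  qed
qed

lemma E_tree_snoc:
  assumes f: "E_tree k f" and s: "s @ [n] \<in> nondec_le k"
  shows "f (s @ [n]) = f s @ [last (f (s @ [n]))]"
proof -
  have s': "s \<in> nondec_le k" using butlast_nondec_le[OF s] by simp
  have "strict_prefix s (s @ [n])" by (simp add: strict_prefix_def)
  then have "strict_prefix (f s) (f (s @ [n]))"
    using f s s' by (auto simp: E_tree_def)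
  then obtain zs where zs: "f (s @ [n]) = f s @ zs" "zs \<noteq> []"
    by (auto simp: strict_prefix_def prefix_def)
  moreover have "length zs = 1"
    using zs E_tree_length[OF f s] E_tree_length[OF f s'] by simp
  ultimately show ?thesis
    by (auto simp: length_Suc_conv)
qed

text \<open>The two images share the stem \<open>f s\<close>, so equal last entries would make them
  equal, against irreflexivity.\<close>

lemma E_tree_last_mono:
  assumes f: "E_tree k f" and n: "s @ [n] \<in> nondec_le k" and m: "s @ [m] \<in> nondec_le k"
    and "n < m"
  shows "last (f (s @ [n])) < last (f (s @ [m]))"
proof -
  have "seq_prec (s @ [n]) (s @ [m])"
    using \<open>n < m\<close> by (simp add: seq_prec_def)
  then have "seq_prec (f (s @ [n])) (f (s @ [m]))"
    using f n m by (auto simp: E_tree_def)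
  moreover have "f (s @ [n]) \<noteq> []"
    using E_tree_length[OF f n] by auto
  ultimately show ?thesis
    using E_tree_snoc[OF f n] E_tree_snoc[OF f m] lex_less_irrefl
    by (metis seq_prec_def)
qed

lemma E_space_subset:
  assumes "X \<in> E_space k"
  shows "X \<subseteq> nondec_eq k"
proof -
  obtain f where f: "E_tree k f" and X: "X = f ` nondec_eq k"
    using assms by (auto simp: E_space_def)
  show ?thesis
  proof
    fix s assume "s \<in> X"
    then obtain t where t: "t \<in> nondec_eq k" "s = f t" using X by blast
    then have "s \<in> nondec_le k"
      using f nondec_eq_subset by (fastforce simp: E_tree_def)
    then show "s \<in> nondec_eq k"
      using E_tree_length[OF f, of t] t nondec_eq_subset
      by (auto simp: nondec_eq_def nondec_le_def)
  qed
qed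

lemma E_space_length: "X \<in> E_space k \<Longrightarrow> s \<in> X \<Longrightarrow> length s = k"
  using E_space_subset by (auto simp: nondec_eq_def)

lemma E_space_positive:
  assumes "X \<in> E_space k"
  shows "X \<notin> Fin_tensor k"
proof -
  obtain f where f: "E_tree k f" and X: "X = f ` nondec_eq k"
    using assms by (auto simp: E_space_def)
  \<comment> \<open>Downward induction from the leaves. At a leaf the section contains
    \<open>[]\<close>, so it is not in \<open>Fin_tensor 0\<close>; at an inner node distinct
    successors have distinct last entries, which yields infinitely many positive fibers.\<close>
  have "{js. f s @ js \<in> X} \<notin> Fin_tensor (k - length s)" if "s \<in> nondec_le k" for s
    using that
  proof (induction "k - length s" arbitrary: s)
    case 0
    then have "s \<in> nondec_eq k" by (auto simp: nondec_le_def nondec_eq_def)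
    then have "[] \<in> {js. f s @ js \<in> X}" using X by auto
    with 0 show ?case by (metis Fin_tensor.simps(1) empty_iff singletonD)
  next
    case (Suc d)
    let ?A = "{js. f s @ js \<in> X}" and ?b = "if s = [] then 0 else last s"
    have snoc: "s @ [n] \<in> nondec_le k" if "?b \<le> n" for n
      using Suc that by (intro snoc_nondec_le) (auto split: if_splits)
    have "fiber ?A (last (f (s @ [n]))) \<notin> Fin_tensor d" if "?b \<le> n" for n
    proof -
      have "{js. f (s @ [n]) @ js \<in> X} \<notin> Fin_tensor d"
        using Suc(1)[OF _ snoc[OF that]] Suc(2)
        by (metis Suc_diff_Suc Suc_inject length_append_singleton zero_less_Suc zero_less_diff)
      then show ?thesis
        by (subst (asm) E_tree_snoc[OF f snoc[OF that]]) (simp add: fiber_def)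
    qed
    then have "(\<lambda>n. last (f (s @ [n]))) ` {?b..} \<subseteq> {c. fiber ?A c \<notin> Fin_tensor d}"
      by auto
    moreover have "inj_on (\<lambda>n. last (f (s @ [n]))) {?b..}"
      by (rule linorder_inj_onI) (use E_tree_last_mono[OF f snoc snoc] in fastforce)+
    then have "infinite ((\<lambda>n. last (f (s @ [n]))) ` {?b..})"
      by (simp add: finite_image_iff infinite_Ici)
    ultimately have "infinite {c. fiber ?A c \<notin> Fin_tensor d}"
      using finite_subset by blast
    then show ?case
      using Suc(2) by (metis Fin_tensor_Suc eventually_cofinite)
  qed
  from this[of "[]"] show ?thesis
    using E_tree_length[OF f, of "[]"] by (simp add: nondec_le_def)
qed

lemma positive_contains_E_space:
  assumes A: "A \<subseteq> nondec_eq k" and pos: "A \<notin> Fin_tensor k"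
  shows "\<exists>X\<in>E_space k. X \<subseteq> A"
proof -
  \<comment> \<open>Nodes are the stems over which \<open>A\<close> is still positive. Below length
    \<open>k\<close> each has infinitely many successor nodes, so the next entry can be chosen
    arbitrarily large.\<close>
  define node where "node s \<longleftrightarrow> length s \<le> k \<and> {js. s @ js \<in> A} \<notin> Fin_tensor (k - length s)" for s
  have node_le: "s \<in> nondec_le k" if "node s" for s
  proof -
    have "{js. s @ js \<in> A} \<noteq> {}"
      using that unfolding node_def by (metis Fin_tensor_empty)
    then show ?thesis
      using A by (auto simp: nondec_le_def nondec_eq_def sorted_append)
  qed
  have node_snoc: "infinite {n. node (s @ [n])}" if s: "node s" "length s < k" for s
  proof -
    let ?A = "{js. s @ js \<in> A}"
    obtain d where d: "k - length s = Suc d" using s(2) by (metis Suc_diff_Suc)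
    have "infinite {n. fiber ?A n \<notin> Fin_tensor d}"
      using s d A by (subst positive_iff_fibers[symmetric]) (auto simp: node_def nondec_eq_def)
    moreover have "{n. fiber ?A n \<notin> Fin_tensor d} \<subseteq> {n. node (s @ [n])}"
    proof
      have "k - Suc (length s) = d" using d by simp
      then show "n \<in> {n. node (s @ [n])}" if "n \<in> {n. fiber ?A n \<notin> Fin_tensor d}" for n
        using that s(2) by (simp add: node_def fiber_def)
    qed
    ultimately show ?thesis
      using finite_subset by blast
  qed
  define R where "R = {(t, s). t \<in> nondec_le k \<and> s \<in> nondec_le k \<and> seq_prec t s}"
  define P :: "(nat list \<Rightarrow> nat list) \<Rightarrow> nat list \<Rightarrow> nat list \<Rightarrow> bool" where
    "P f s v \<longleftrightarrow> (s \<in> nondec_le k \<longrightarrow> node v \<and> length v = length s \<and>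
      (s \<noteq> [] \<longrightarrow> v \<noteq> [] \<and> butlast v = f (butlast s) \<and>
        (\<forall>t\<in>nondec_le k. seq_prec t s \<longrightarrow> t \<noteq> [] \<longrightarrow> last (f t) < last v)))"
    for f s v
  \<comment> \<open>Well-founded choice applies because \<open>P f s\<close> reads \<open>f\<close>
    only at predecessors of \<open>s\<close>, among them \<open>butlast s\<close>.\<close>
  have "\<exists>f. \<forall>s. P f s (f s)"
  proof (rule dependent_wf_choice)
    show "wf R" unfolding R_def by (rule wf_seq_prec)
    fix f g :: "nat list \<Rightarrow> nat list" and s v assume "\<And>z. (z, s) \<in> R \<Longrightarrow> f z = g z"
    then show "P f s v = P g s v"
      by (auto simp: P_def R_def butlast_nondec_le seq_prec_butlast)
  next
    fix s and f :: "nat list \<Rightarrow> nat list" assume IH: "\<And>t. (t, s) \<in> R \<Longrightarrow> P f t (f t)"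
    show "\<exists>v. P f s v"
    proof (cases "s \<in> nondec_le k \<and> s \<noteq> []")
      case False
      \<comment> \<open>For \<open>s = []\<close>, \<open>node []\<close> is positivity of
        \<open>A\<close>; outside \<open>nondec_le k\<close> the condition is vacuous.\<close>
      then show ?thesis using pos by (auto simp: P_def node_def intro!: exI[of _ "[]"])
    next
      case True
      then have "P f (butlast s) (f (butlast s))"
        by (intro IH) (auto simp: R_def butlast_nondec_le seq_prec_butlast)
      with True have b: "node (f (butlast s))" "length (f (butlast s)) = length s - 1"
        by (auto simp: P_def butlast_nondec_le)
      have "length s - 1 < k" using True by (cases s) (auto simp: nondec_le_def)
      with b have inf: "infinite {n. node (f (butlast s) @ [n])}" by (simp add: node_snoc)
      have "finite ((\<lambda>t. last (f t)) ` {t \<in> nondec_le k. seq_prec t s})" (is "finite ?L")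
        using finite_predecessors by simp
      then obtain c where c: "\<forall>x\<in>?L. x \<le> c"
        using finite_nat_set_iff_bounded_le by blast
      obtain n where n: "node (f (butlast s) @ [n])" "n > c"
        using inf unfolding infinite_nat_iff_unbounded by blast
      have "last (f t) < n" if "t \<in> nondec_le k" "seq_prec t s" for t
        using that c n(2) by fastforce
      moreover have "length s \<noteq> 0" using True by simp
      ultimately have "P f s (f (butlast s) @ [n])"
        using b(2) n(1) unfolding P_def by simp
      then show ?thesis by blast
    qed
  qed
  then obtain f where f: "\<And>s. P f s (f s)" by blast
  have node_f: "node (f s)" and len_f: "length (f s) = length s" if "s \<in> nondec_le k" for s
    using f[of s] that by (auto simp: P_def)
  have "E_tree k f"
    unfolding E_tree_def
  proof (intro conjI ballI impI)
    show "f ` nondec_le k \<subseteq> nondec_le k"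
      using node_f node_le by auto
  next
    fix t s assume *: "t \<in> nondec_le k" "s \<in> nondec_le k" "seq_prec t s"
    then have "s \<noteq> []" by (auto simp: seq_prec_def split: if_splits)
    moreover from this have "t \<noteq> [] \<Longrightarrow> last (f t) < last (f s)"
      using f[of s] * by (auto simp: P_def)
    \<comment> \<open>Last entries of values increase strictly, so the lexicographic clause never
      has to be checked.\<close>
    ultimately show "seq_prec (f t) (f s)"
      using len_f[OF *(1)] len_f[OF *(2)] by (cases "t = []") (auto simp: seq_prec_def)
  next
    fix t s assume "t \<in> nondec_le k" "s \<in> nondec_le k" "strict_prefix t s"
    then show "strict_prefix (f t) (f s)"
    proof (induction s rule: rev_induct)
      case (snoc x s)
      have s: "s \<in> nondec_le k" using butlast_nondec_le[OF snoc.prems(2)] by simp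
      have "strict_prefix (f s) (f (s @ [x]))"
        using f[of "s @ [x]"] snoc.prems(2)
        by (metis P_def append_butlast_last_id butlast_snoc snoc_eq_iff_butlast strict_prefixI')
      moreover have "t = s \<or> strict_prefix t s"
        using snoc.prems(3) by (auto simp: strict_prefix_def)
      ultimately show ?case
        using snoc.IH[OF snoc.prems(1) s] by auto
    qed simp
  qed
  moreover have "f ` nondec_eq k \<subseteq> A"
  proof
    fix v assume "v \<in> f ` nondec_eq k"
    then obtain s where s: "s \<in> nondec_eq k" "v = f s" by blast
    then have "node v" "length v = k"
      using node_f len_f nondec_eq_subset by (auto simp: nondec_eq_def)
    \<comment> \<open>At length \<open>k\<close>, being a node means having a nonempty
      section.\<close>
    then obtain js where "v @ js \<in> A" by (auto simp: node_def)
    with \<open>length v = k\<close> A have "js = []" by (fastforce simp: nondec_eq_def)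
    with \<open>v @ js \<in> A\<close> show "v \<in> A" by simp
  qed
  ultimately show ?thesis
    by (auto simp: E_space_def)
qed

text \<open>Almost disjointness from \<open>C b\<close> is almost inclusion in its complement. The
  positive sets \<open>D\<close> minus finitely many \<open>C b\<close> are genuinely included in
  the complements removed so far, so \<open>positive_diagonal\<close> applies.\<close>

lemma avoid_countably_many:
  assumes len: "\<And>s. s \<in> D \<Longrightarrow> length s = Suc k"
    and S: "countable S"
    and pos: "\<And>G. finite G \<Longrightarrow> G \<subseteq> S \<Longrightarrow> D - (\<Union>b\<in>G. C b) \<notin> Fin_tensor (Suc k)"
  shows "\<exists>B \<subseteq> D. B \<notin> Fin_tensor (Suc k) \<and> (\<forall>b\<in>S. B \<inter> C b \<in> Fin_tensor (Suc k))"
proof (cases "S = {}")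
  case True
  then show ?thesis using pos[of "{}"] by auto
next
  case False
  define e where "e = from_nat_into S"
  have range: "range e = S"
    using range_from_nat_into[OF False S] by (simp add: e_def)
  define Y where "Y i = D - (\<Union>b\<in>e ` {..i}. C b)" for i
  have Y_pos: "Y i \<notin> Fin_tensor (Suc k)" for i
    unfolding Y_def using range by (intro pos) auto
  have Y_sub: "almost_subset (Suc k) (Y i) (- C (e j))" if "j \<le> i" for i j
  proof -
    have "Y i - - C (e j) = {}" using that by (auto simp: Y_def)
    then show ?thesis by (simp add: almost_subset_def)
  qed
  have Y_len: "length s = Suc k" if "s \<in> Y i" for i s
    using that len by (simp add: Y_def)
  have "\<exists>B \<subseteq> (\<Union>i. Y i). B \<notin> Fin_tensor (Suc k) \<and> (\<forall>j. almost_subset (Suc k) B (- C (e j)))"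
    using Y_len Y_pos Y_sub by (rule positive_diagonal)
  then obtain B where B: "B \<subseteq> (\<Union>i. Y i)" "B \<notin> Fin_tensor (Suc k)"
    "\<And>j. almost_subset (Suc k) B (- C (e j))"
    by blast
  show ?thesis
  proof (intro exI[of _ B] conjI ballI)
    show "B \<subseteq> D" using B(1) by (auto simp: Y_def)
    show "B \<notin> Fin_tensor (Suc k)" by (rule B(2))
    fix b assume "b \<in> S"
    then obtain j where "b = e j" using range by blast
    then show "B \<inter> C b \<in> Fin_tensor (Suc k)"
      using B(3)[of j] by (simp add: almost_subset_def Diff_eq)
  qed
qed

subsection \<open>Countable families\<close>

lemma E_space_nonempty: "E_space k \<noteq> {}"
proof -
  have "E_tree k id" by (auto simp: E_tree_def)
  then show ?thesis by (auto simp: E_space_def)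
qed

lemma countable_SFIP_pseudointersection:
  assumes F: "F \<subseteq> E_space (Suc k)" "SFIP (Suc k) F" "countable F"
  shows "\<exists>Y. pseudointersection (Suc k) F Y"
proof (cases "F = {}")
  case True
  then show ?thesis using E_space_nonempty by (auto simp: pseudointersection_def)
next
  case False
  define X where "X = from_nat_into F"
  have range: "range X = F"
    using range_from_nat_into[OF False F(3)] by (simp add: X_def)
  have "\<exists>Y\<in>E_space (Suc k). \<forall>j\<le>i. almost_subset (Suc k) Y (X j)" for i
    using F(2)[unfolded SFIP_def, rule_format, of "X ` {..i}"] range by auto
  then obtain Y where Y: "\<And>i. Y i \<in> E_space (Suc k)"
    "\<And>i j. j \<le> i \<Longrightarrow> almost_subset (Suc k) (Y i) (X j)"
    by metis
  have "\<exists>A \<subseteq> (\<Union>i. Y i). A \<notin> Fin_tensor (Suc k) \<and> (\<forall>j. almost_subset (Suc k) A (X j))"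
    using E_space_length[OF Y(1)] E_space_positive[OF Y(1)] Y(2) by (rule positive_diagonal)
  then obtain A where A: "A \<subseteq> (\<Union>i. Y i)" "A \<notin> Fin_tensor (Suc k)"
    "\<And>j. almost_subset (Suc k) A (X j)"
    by blast
  \<comment> \<open>Lying in the union of the \<open>Y i\<close> keeps all sequences of
    \<open>A\<close> non-decreasing, as thinning out requires.\<close>
  have "A \<subseteq> nondec_eq (Suc k)"
    using A(1) E_space_subset[OF Y(1)] by blast
  then obtain Z where Z: "Z \<in> E_space (Suc k)" "Z \<subseteq> A"
    using positive_contains_E_space[OF _ A(2)] by blast
  have "almost_subset (Suc k) Z (X j)" for j
    using A(3)[of j] Z(2) unfolding almost_subset_def
    by (elim Fin_tensor_subset) auto
  then show ?thesis
    using Z(1) range unfolding pseudointersection_def by blast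
qed

lemma linear_finite_lower_bound:
  assumes "finite G" "G \<noteq> {}"
    "\<forall>X\<in>G. \<forall>Y\<in>G. almost_subset k Y X \<or> almost_subset k X Y"
  shows "\<exists>Y\<in>G. \<forall>X\<in>G. almost_subset k Y X"
  using assms
proof (induction G rule: finite_ne_induct)
  case (singleton X)
  then show ?case by (simp add: almost_subset_refl)
next
  case (insert X G)
  then obtain Y where Y: "Y \<in> G" "\<forall>Z\<in>G. almost_subset k Y Z" by blast
  then consider "almost_subset k Y X" | "almost_subset k X Y" using insert.prems by blast
  then show ?case
  proof cases
    case 2
    then show ?thesis
      using Y almost_subset_trans almost_subset_refl by (intro bexI[of _ X]) blast+
  qed (use Y in blast)
qed

text \<open>A finite nonempty linear family has an almost-least member, so linear families have the
  SFIP. Lower bounds for the p-number thus carry over to the t-number.\<close>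

lemma t_families_subset_p_families: "t_families k \<subseteq> p_families k"
proof
  fix F assume F: "F \<in> t_families k"
  have "\<exists>Y\<in>E_space k. \<forall>X\<in>G. almost_subset k Y X" if G: "G \<subseteq> F" "finite G" for G
  proof (cases "G = {}")
    case True
    then show ?thesis using E_space_nonempty by auto
  next
    case False
    have "\<forall>X\<in>G. \<forall>Y\<in>G. almost_subset k Y X \<or> almost_subset k X Y"
      using F G(1) unfolding t_families_def by blast
    then show ?thesis
      using linear_finite_lower_bound[OF G(2) False] F G(1) unfolding t_families_def by blast
  qed
  then show "F \<in> p_families k"
    using F by (auto simp: p_families_def t_families_def SFIP_def)
qed

subsection \<open>The tower\<close>

lemma uncountable_iff_omega1_ordLeq: "uncountable A \<longleftrightarrow> omega1 \<le>o |A|"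
proof -
  have "uncountable A \<longleftrightarrow> natLeq <o |A|"
    by (simp add: countable_card_le_natLeq natLeq_Well_order card_of_Well_order
        not_ordLeq_iff_ordLess)
  then show ?thesis
    by (simp add: cardSuc_ordLess_ordLeq natLeq_Card_order card_of_Card_order)
qed

lemma p_families_omega1: "F \<in> p_families (Suc k) \<Longrightarrow> omega1 \<le>o |F|"
  using countable_SFIP_pseudointersection
  by (auto simp: p_families_def uncountable_iff_omega1_ordLeq[symmetric])

lemma countable_underS_omega1:
  assumes "a \<in> Field omega1"
  shows "countable (underS omega1 a)"
proof -
  have "|underS omega1 a| <o omega1"
    using assms by (intro card_of_underS cardSuc_Card_order natLeq_Card_order)
  then show ?thesis
    by (simp add: countable_card_le_natLeq cardSuc_ordLeq_ordLess natLeq_Card_order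
        card_of_Card_order)
qed

lemma uncountable_Field_omega1: "uncountable (Field omega1)"
  unfolding uncountable_iff_omega1_ordLeq
  by (meson card_of_Field_ordIso cardSuc_Card_order natLeq_Card_order ordIso_iff_ordLeq)

lemma underS_total:
  assumes "Well_order r" "a \<in> Field r" "b \<in> Field r" "a \<noteq> b"
  shows "a \<in> underS r b \<or> b \<in> underS r a"
  using assms unfolding underS_def order_on_defs total_on_def by auto

lemma underS_trans:
  assumes "Well_order r" "a \<in> underS r b" "b \<in> underS r c"
  shows "a \<in> underS r c"
  using assms unfolding underS_def order_on_defs trans_def antisym_def by blast

lemma finite_has_greatest_underS:
  assumes r: "Well_order r" and G: "finite G" "G \<noteq> {}" "G \<subseteq> Field r"
  shows "\<exists>d\<in>G. \<forall>b\<in>G. b = d \<or> b \<in> underS r d"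
  using G
proof (induction G rule: finite_ne_induct)
  case (insert x G)
  then obtain d where "d \<in> G" "\<forall>b\<in>G. b = d \<or> b \<in> underS r d" by blast
  moreover from this have "x = d \<or> x \<in> underS r d \<or> d \<in> underS r x"
    using underS_total[OF r] insert.prems by blast
  ultimately show ?case
    using underS_trans[OF r] by (metis insert_iff)
qed simp

text \<open>The last clause says that no fiber of \<open>X c\<close> is covered, modulo the ideal, by the fibers of
  finitely many later members; this leaves room below \<open>X c\<close> at every later stage.\<close>

definition tower_step ::
    "nat \<Rightarrow> 'a rel \<Rightarrow> ('a \<Rightarrow> nat list set) \<Rightarrow> 'a \<Rightarrow> nat list set \<Rightarrow> bool" where
  "tower_step k r X a Y \<longleftrightarrow> Y \<in> E_space (Suc k) \<and>
     (\<forall>b\<in>underS r a. almost_subset (Suc k) Y (X b)) \<and>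
     (\<forall>n. finite {b \<in> underS r a. fiber Y n \<inter> fiber (X b) n \<notin> Fin_tensor k}) \<and>
     (\<forall>n. \<forall>c\<in>underS r a. \<forall>G. finite G \<longrightarrow> G \<subseteq> underS r a \<longrightarrow> (\<forall>b\<in>G. c \<in> underS r b) \<longrightarrow>
        fiber (X c) n \<notin> Fin_tensor k \<longrightarrow>
        fiber (X c) n - (fiber Y n \<union> (\<Union>b\<in>G. fiber (X b) n)) \<notin> Fin_tensor k)"

lemma
  assumes "tower_step k r X a Y"
  shows tower_step_E_space: "Y \<in> E_space (Suc k)"
    and tower_step_almost_subset: "b \<in> underS r a \<Longrightarrow> almost_subset (Suc k) Y (X b)"
    and tower_step_finite: "finite {b \<in> underS r a. fiber Y n \<inter> fiber (X b) n \<notin> Fin_tensor k}"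
    and tower_step_reserve: "c \<in> underS r a \<Longrightarrow> fiber (X c) n \<notin> Fin_tensor k \<Longrightarrow>
      finite G \<Longrightarrow> G \<subseteq> underS r a \<Longrightarrow> \<forall>b\<in>G. c \<in> underS r b \<Longrightarrow>
      fiber (X c) n - (fiber Y n \<union> (\<Union>b\<in>G. fiber (X b) n)) \<notin> Fin_tensor k"
  using assms by (simp_all add: tower_step_def)

text \<open>Locality of the step, as required for recursion along \<open>omega1\<close>.\<close>

lemma tower_step_cong:
  assumes "\<And>b. b \<in> underS r a \<Longrightarrow> X b = X' b"
  shows "tower_step k r X a Y \<longleftrightarrow> tower_step k r X' a Y"
proof -
  have "(\<Union>b\<in>G. fiber (X b) n) = (\<Union>b\<in>G. fiber (X' b) n)" if "G \<subseteq> underS r a" for G n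
    using assms that by (intro SUP_cong) auto
  then show ?thesis
    unfolding tower_step_def using assms by (simp cong: conj_cong imp_cong)
qed

lemma tower_step_exists:
  assumes r: "Well_order r" and a: "a \<in> Field r" and count: "countable (underS r a)"
    and IH: "\<And>b. b \<in> underS r a \<Longrightarrow> tower_step (Suc k) r X b (X b)"
  shows "\<exists>Y. tower_step (Suc k) r X a Y"
proof (cases "underS r a = {}")
  case True
  then show ?thesis using E_space_nonempty by (auto simp: tower_step_def)
next
  case False
  let ?K = "Suc k"
  note X_E = tower_step_E_space[OF IH]
  have X_len: "length s = ?K" if "b \<in> underS r a" "s \<in> fiber (X b) n" for b s n
    using E_space_length[OF X_E[OF that(1)], of "n # s"] that(2) by simp
  \<comment> \<open>The reserve property among the members already built: the clause is applied at
    the greatest index \<open>d\<close> of \<open>G\<close>, with \<open>X d\<close> as the new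
    member and \<open>G - {d}\<close> as the finite set.\<close>
  have reserve: "fiber (X c) n - (\<Union>b\<in>G. fiber (X b) n) \<notin> Fin_tensor ?K"
    if c: "c \<in> underS r a" "fiber (X c) n \<notin> Fin_tensor ?K"
      and G: "finite G" "G \<subseteq> underS r a" "\<forall>b\<in>G. c \<in> underS r b" for c n G
  proof (cases "G = {}")
    case False
    have "G \<subseteq> Field r" using G(2) underS_Field by fastforce
    then obtain d where d: "d \<in> G" "\<forall>b\<in>G. b = d \<or> b \<in> underS r d"
      using finite_has_greatest_underS[OF r G(1) False] by blast
    have "fiber (X c) n - (fiber (X d) n \<union> (\<Union>b\<in>G - {d}. fiber (X b) n)) \<notin> Fin_tensor ?K"
      using c G d by (intro tower_step_reserve[OF IH]) auto
    moreover have "fiber (X d) n \<union> (\<Union>b\<in>G - {d}. fiber (X b) n) = (\<Union>b\<in>G. fiber (X b) n)"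
      using d(1) by auto
    ultimately show ?thesis by simp
  qed (use c in simp)

  define e where "e = from_nat_into (underS r a)"
  have range: "range e = underS r a"
    using range_from_nat_into[OF False count] by (simp add: e_def)
  have "\<exists>d\<in>e ` {..i}. \<forall>b\<in>e ` {..i}. b = d \<or> b \<in> underS r d" for i
    using range underS_Field[of _ r a] by (intro finite_has_greatest_underS[OF r]) auto
  \<comment> \<open>\<open>g i\<close> is the latest of \<open>e 0, ..., e i\<close>, so
    \<open>X (g i)\<close> is almost contained in each \<open>X (e j)\<close> with
    \<open>j \<le> i\<close>.\<close>
  then obtain g where g_e: "\<And>i. g i \<in> e ` {..i}"
    and g_max: "\<And>i b. b \<in> e ` {..i} \<Longrightarrow> b = g i \<or> b \<in> underS r (g i)"
    by metis
  have g: "g i \<in> underS r a" for i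
    using g_e[of i] range by auto
  have g_sub: "almost_subset (Suc ?K) (X (g i)) (X (e j))" if "j \<le> i" for i j
    using g_max[of "e j" i] that almost_subset_refl tower_step_almost_subset[OF IH[OF g]] by auto
  let ?good = "\<lambda>i n. fiber (X (g i)) n \<notin> Fin_tensor ?K \<and>
    (\<forall>j\<le>i. fiber (X (g i)) n - fiber (X (e j)) n \<in> Fin_tensor ?K)"
  have "infinite {n. ?good i n}" for i
    using E_space_length[OF X_E[OF g]] E_space_positive[OF X_E[OF g]] g_sub
    by (rule infinitely_many_good_fibers)
  then obtain h where h: "strict_mono h" and good: "\<And>i. ?good i (h i)"
    using strict_mono_choice[of ?good] by blast
  have h_pos: "fiber (X (g i)) (h i) \<notin> Fin_tensor ?K" for i
    using good by blast
  have h_sub: "fiber (X (g i)) (h i) - fiber (X (e j)) (h i) \<in> Fin_tensor ?K" if "j \<le> i" for i j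
    using good that by blast

  \<comment> \<open>By the reserve property, the fiber of \<open>X (g i)\<close> contains a positive
    set almost disjoint from all members between \<open>g i\<close> and \<open>a\<close>.\<close>
  have "\<exists>B \<subseteq> fiber (X (g i)) (h i). B \<notin> Fin_tensor ?K \<and>
      (\<forall>b\<in>{b \<in> underS r a. g i \<in> underS r b}. B \<inter> fiber (X b) (h i) \<in> Fin_tensor ?K)" for i
  proof (rule avoid_countably_many)
    show "length s = ?K" if "s \<in> fiber (X (g i)) (h i)" for s
      using X_len[OF g that] .
    show "countable {b \<in> underS r a. g i \<in> underS r b}"
      using count by (rule countable_subset[rotated]) auto
    show "fiber (X (g i)) (h i) - (\<Union>b\<in>G. fiber (X b) (h i)) \<notin> Fin_tensor ?K"
      if "finite G" "G \<subseteq> {b \<in> underS r a. g i \<in> underS r b}" for G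
      using that by (intro reserve g h_pos) auto
  qed
  then obtain B where B_sub: "\<And>i. B i \<subseteq> fiber (X (g i)) (h i)"
    and B_pos: "\<And>i. B i \<notin> Fin_tensor ?K"
    and B_avoid: "\<And>i b. b \<in> underS r a \<Longrightarrow> g i \<in> underS r b \<Longrightarrow>
      B i \<inter> fiber (X b) (h i) \<in> Fin_tensor ?K"
    by (metis (mono_tags, lifting) mem_Collect_eq)
  have B_len: "length s = ?K" if "s \<in> B i" for s i
    using that B_sub X_len[OF g] by blast
  \<comment> \<open>\<open>C i\<close> goes into the new member; \<open>B i - C i\<close> is kept as
    reserve for \<open>X (g i)\<close>. The split is possible because fibers have exponent at least
    one.\<close>
  have "\<exists>C \<subseteq> B i. C \<notin> Fin_tensor ?K \<and> B i - C \<notin> Fin_tensor ?K" for i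
    using B_len B_pos by (rule positive_split)
  then obtain C where C_sub: "\<And>i. C i \<subseteq> B i" and C_pos: "\<And>i. C i \<notin> Fin_tensor ?K"
    and C_rest: "\<And>i. B i - C i \<notin> Fin_tensor ?K"
    by metis
  have C_len: "length s = ?K" if "s \<in> C i" for s i
    using that C_sub B_len by blast

  let ?A = "glue h C"
  have "?A \<subseteq> nondec_eq (Suc ?K)"
    using C_sub B_sub E_space_subset[OF X_E[OF g]] by (fastforce simp: glue_def)
  then obtain Y where Y: "Y \<in> E_space (Suc ?K)" "Y \<subseteq> ?A"
    using positive_contains_E_space[OF _ glue_positive[of h C, OF h C_pos]] by blast
  have Y_in: "fiber Y (h i) \<subseteq> C i" for i
    using fiber_mono[OF Y(2)] fiber_glue[OF h] by blast
  have Y_out: "fiber Y n = {}" if "n \<notin> range h" for n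
    using fiber_mono[OF Y(2)] fiber_glue_outside[OF that] by blast

  have "tower_step ?K r X a Y"
    unfolding tower_step_def
  proof (intro conjI ballI allI impI)
    show "Y \<in> E_space (Suc ?K)" by (rule Y(1))
  next
    fix b assume "b \<in> underS r a"
    then obtain j where j: "b = e j" using range by blast
    have "C i - fiber (X b) (h i) \<in> Fin_tensor ?K" if "j \<le> i" for i
      using h_sub[OF that] C_sub B_sub j by (blast intro: Fin_tensor_subset)
    then have "almost_subset (Suc ?K) ?A (X b)"
      using h C_len by (intro glue_almost_subset)
    then show "almost_subset (Suc ?K) Y (X b)"
      using Y(2) unfolding almost_subset_def by (blast intro: Fin_tensor_subset)
  next
    fix n
    show "finite {b \<in> underS r a. fiber Y n \<inter> fiber (X b) n \<notin> Fin_tensor ?K}" (is "finite ?S")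
    proof (cases "n \<in> range h")
      case True
      then obtain i where i: "n = h i" by blast
      \<comment> \<open>Indices after \<open>g i\<close> are excluded by the choice of
        \<open>B i\<close>. Those before \<open>g i\<close> already meet the fiber of
        \<open>X (g i)\<close> positively, so the step at \<open>g i\<close> leaves only finitely
        many.\<close>
      have "?S \<subseteq> insert (g i)
          {b \<in> underS r (g i). fiber (X (g i)) n \<inter> fiber (X b) n \<notin> Fin_tensor ?K}" (is "_ \<subseteq> ?T")
      proof
        fix b assume b: "b \<in> ?S"
        have "fiber Y n \<inter> fiber (X b) n \<subseteq> B i \<inter> fiber (X b) n"
          "fiber Y n \<inter> fiber (X b) n \<subseteq> fiber (X (g i)) n \<inter> fiber (X b) n"
          using Y_in[of i] C_sub[of i] B_sub[of i] unfolding i by blast+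
        with b have "B i \<inter> fiber (X b) n \<notin> Fin_tensor ?K"
          "fiber (X (g i)) n \<inter> fiber (X b) n \<notin> Fin_tensor ?K"
          using Fin_tensor_subset by blast+
        moreover have "b = g i \<or> b \<in> underS r (g i) \<or> g i \<in> underS r b"
          using underS_total[OF r] b g underS_Field by fastforce
        ultimately show "b \<in> ?T"
          using B_avoid b i by blast
      qed
      then show ?thesis
        using tower_step_finite[OF IH[OF g]] by (meson finite.insertI finite_subset)
    qed (simp add: Y_out)
  next
    fix n c G
    assume c: "c \<in> underS r a" "fiber (X c) n \<notin> Fin_tensor ?K"
      and G: "finite G" "G \<subseteq> underS r a" "\<forall>b\<in>G. c \<in> underS r b"
    let ?U = "\<lambda>G. \<Union>b\<in>G. fiber (X b) n"
    show "fiber (X c) n - (fiber Y n \<union> ?U G) \<notin> Fin_tensor ?K"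
    proof (cases "n \<in> range h")
      case False
      then show ?thesis using reserve[OF c G] by (simp add: Y_out)
    next
      case True
      then obtain i where i: "n = h i" by blast
      have "c = g i \<or> c \<in> underS r (g i) \<or> g i \<in> underS r c"
        using underS_total[OF r] c(1) g underS_Field by fastforce
      then consider "c \<in> underS r (g i)" | "c = g i" | "g i \<in> underS r c" by blast
      then show ?thesis
      proof cases
        case 1
        \<comment> \<open>The fiber of \<open>Y\<close> lies in that of \<open>X (g i)\<close>,
          which may be added to \<open>G\<close>.\<close>
        have "fiber (X c) n - ?U (insert (g i) G) \<notin> Fin_tensor ?K"
          using G g 1 by (intro reserve[OF c]) auto
        moreover have "fiber (X c) n - ?U (insert (g i) G) \<subseteq> fiber (X c) n - (fiber Y n \<union> ?U G)"
          using Y_in[of i] C_sub[of i] B_sub[of i] unfolding i by blast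
        ultimately show ?thesis using Fin_tensor_subset by blast
      next
        case 2
        \<comment> \<open>The reserve \<open>B i - C i\<close> is disjoint from the fiber of
          \<open>Y\<close> and almost disjoint from all members of \<open>G\<close>.\<close>
        have "(\<Union>b\<in>G. B i \<inter> fiber (X b) n) \<in> Fin_tensor ?K"
          using G 2 B_avoid unfolding i by (intro Fin_tensor_UN) auto
        moreover have "B i - C i
            \<subseteq> (fiber (X c) n - (fiber Y n \<union> ?U G)) \<union> (\<Union>b\<in>G. B i \<inter> fiber (X b) n)"
          using B_sub[of i] Y_in[of i] unfolding i 2 by blast
        ultimately show ?thesis
          using C_rest[of i] Fin_tensor_cover by blast
      next
        case 3
        \<comment> \<open>Here the fiber of \<open>Y\<close> meets that of \<open>X c\<close> in a
          small set, so removing it changes nothing modulo the ideal.\<close>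
        have "B i \<inter> fiber (X c) n \<in> Fin_tensor ?K"
          using B_avoid[OF c(1) 3] i by simp
        moreover have "fiber (X c) n - ?U G
            \<subseteq> (fiber (X c) n - (fiber Y n \<union> ?U G)) \<union> (B i \<inter> fiber (X c) n)"
          using Y_in[of i] C_sub[of i] unfolding i by blast
        ultimately show ?thesis
          using reserve[OF c G] Fin_tensor_cover by blast
      qed
    qed
  qed
  then show ?thesis by blast
qed

lemma tower_exists:
  "\<exists>X. \<forall>a\<in>Field omega1. tower_step (Suc k) omega1 X a (X a)"
proof -
  have r: "Well_order omega1"
    using card_order_on_well_order_on[OF cardSuc_Card_order[OF natLeq_Card_order]] .
  have R: "(b, a) \<in> omega1 - Id \<longleftrightarrow> b \<in> underS omega1 a" for a b
    by (auto simp: underS_def)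
  have "\<exists>X. \<forall>a. a \<in> Field omega1 \<longrightarrow> tower_step (Suc k) omega1 X a (X a)"
  proof (rule dependent_wf_choice)
    show "wf (omega1 - Id)" using r by (simp add: well_order_on_def)
  next
    fix X X' :: "nat set \<Rightarrow> nat list set" and a Y
    assume "\<And>b. (b, a) \<in> omega1 - Id \<Longrightarrow> X b = X' b"
    then show "(a \<in> Field omega1 \<longrightarrow> tower_step (Suc k) omega1 X a Y) \<longleftrightarrow>
        (a \<in> Field omega1 \<longrightarrow> tower_step (Suc k) omega1 X' a Y)"
      using tower_step_cong[of omega1 a X X'] unfolding R by blast
  next
    fix a and X :: "nat set \<Rightarrow> nat list set"
    assume "\<And>b. (b, a) \<in> omega1 - Id \<Longrightarrow>
      b \<in> Field omega1 \<longrightarrow> tower_step (Suc k) omega1 X b (X b)"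
    then have "tower_step (Suc k) omega1 X b (X b)" if "b \<in> underS omega1 a" for b
      using that underS_Field[of b omega1 a] unfolding R by blast
    then show "\<exists>Y. a \<in> Field omega1 \<longrightarrow> tower_step (Suc k) omega1 X a Y"
      using tower_step_exists[OF r _ countable_underS_omega1] by blast
  qed
  then show ?thesis by blast
qed

lemma tower_no_pseudointersection:
  assumes X: "\<And>a. a \<in> Field omega1 \<Longrightarrow> tower_step k omega1 X a (X a)"
  shows "\<not> pseudointersection (Suc k) (X ` Field omega1) Y"
proof
  let ?I = "Field omega1"
  have r: "Well_order omega1"
    using card_order_on_well_order_on[OF cardSuc_Card_order[OF natLeq_Card_order]] .
  assume "pseudointersection (Suc k) (X ` ?I) Y"
  then have Y: "Y \<in> E_space (Suc k)" and sub: "\<And>a. a \<in> ?I \<Longrightarrow> almost_subset (Suc k) Y (X a)"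
    by (auto simp: pseudointersection_def)
  let ?S = "\<lambda>m. {a \<in> ?I. \<forall>n\<ge>m. fiber Y n - fiber (X a) n \<in> Fin_tensor k}"
  have "?I \<subseteq> (\<Union>m. ?S m)"
  proof
    fix a assume a: "a \<in> ?I"
    obtain m where "\<forall>n\<in>{n. fiber Y n - fiber (X a) n \<notin> Fin_tensor k}. n < m"
      using almost_subset_fibers[OF sub[OF a]] finite_nat_set_iff_bounded by blast
    with a have "a \<in> ?S m" by (auto simp: not_le[symmetric])
    then show "a \<in> (\<Union>m. ?S m)" by blast
  qed
  then obtain m where m: "uncountable (?S m)"
    using uncountable_Field_omega1 countable_subset[of ?I "\<Union>m. ?S m"] by blast
  have "infinite {n. fiber Y n \<notin> Fin_tensor k}"
    using positive_iff_fibers[of Y k] E_space_length[OF Y] E_space_positive[OF Y] by blast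
  then obtain n where n: "n > m" "fiber Y n \<notin> Fin_tensor k"
    unfolding infinite_nat_iff_unbounded by blast
  obtain T where T: "T \<subseteq> ?S m" "countable T" "infinite T"
    using infinite_countable_subset'[OF uncountable_infinite[OF m]] by blast
  \<comment> \<open>An index of \<open>?S m\<close> outside this countable set lies above every
    member of \<open>T\<close>.\<close>
  have "countable (T \<union> (\<Union>b\<in>T. underS omega1 b))"
    using T countable_underS_omega1 by auto
  then have "\<not> ?S m \<subseteq> T \<union> (\<Union>b\<in>T. underS omega1 b)"
    using m by (metis (no_types, lifting) countable_subset)
  then obtain a where a: "a \<in> ?S m" "a \<notin> T \<union> (\<Union>b\<in>T. underS omega1 b)"
    by blast
  have "T \<subseteq> {b \<in> underS omega1 a. fiber (X a) n \<inter> fiber (X b) n \<notin> Fin_tensor k}"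
  proof
    fix b assume b: "b \<in> T"
    then have "b \<in> underS omega1 a"
      using underS_total[OF r, of a b] a T(1) by blast
    moreover have "fiber (X a) n \<inter> fiber (X b) n \<notin> Fin_tensor k"
    proof
      assume "fiber (X a) n \<inter> fiber (X b) n \<in> Fin_tensor k"
      \<comment> \<open>The positive fiber of \<open>Y\<close> is almost contained in both fibers,
        hence in their intersection.\<close>
      moreover have "(fiber Y n - fiber (X a) n) \<union> (fiber Y n - fiber (X b) n) \<in> Fin_tensor k"
        using a b T(1) n(1) by (intro Fin_tensor_Un) auto
      ultimately have "fiber Y n \<in> Fin_tensor k"
        by (rule Fin_tensor_cover) blast
      with n(2) show False by blast
    qed
    ultimately show "b \<in> {b \<in> underS omega1 a. fiber (X a) n \<inter> fiber (X b) n \<notin> Fin_tensor k}"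
      by blast
  qed
  moreover have "finite {b \<in> underS omega1 a. fiber (X a) n \<inter> fiber (X b) n \<notin> Fin_tensor k}"
    using a(1) by (intro tower_step_finite X) simp
  ultimately show False
    using T(3) finite_subset by blast
qed

text \<open>The size of the tower is found without injectivity of \<open>X\<close>: an image of
  \<open>Field omega1\<close> has size at most \<open>omega1\<close>, and having no
  pseudointersection forces the converse.\<close>

lemma t_family_omega1: "\<exists>F\<in>t_families (Suc (Suc k)). |F| =o omega1"
proof -
  have card: "Card_order omega1" by (intro cardSuc_Card_order natLeq_Card_order)
  obtain X where X: "\<And>a. a \<in> Field omega1 \<Longrightarrow> tower_step (Suc k) omega1 X a (X a)"
    using tower_exists by blast
  let ?F = "X ` Field omega1"
  have "almost_subset (Suc (Suc k)) (X b) (X a) \<or> almost_subset (Suc (Suc k)) (X a) (X b)"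
    if "a \<in> Field omega1" "b \<in> Field omega1" for a b
    using X[OF that(1)] X[OF that(2)] almost_subset_refl
      underS_total[OF card_order_on_well_order_on[OF card] that] unfolding tower_step_def by metis
  then have F: "?F \<in> t_families (Suc (Suc k))"
    using X tower_no_pseudointersection[of "Suc k" X]
    by (auto simp: t_families_def tower_step_def)
  then have "omega1 \<le>o |?F|"
    using t_families_subset_p_families p_families_omega1 by blast
  moreover have "|?F| \<le>o omega1"
    using card_of_image card_of_Field_ordIso[OF card] ordLeq_ordIso_trans by blast
  ultimately show ?thesis
    using F ordIso_iff_ordLeq by blast
qed

theorem theorem18:
  fixes k :: nat
  assumes "k > 2"
  shows "is_t_number k omega1 \<and> is_p_number k omega1"
proof -
  obtain j where k: "k = Suc (Suc j)"
    using assms by (metis less_imp_Suc_add numeral_2_eq_2 plus_nat.simps(2))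
  have "omega1 \<le>o |F|" if "F \<in> p_families k" for F
    using that k p_families_omega1 by blast
  then show ?thesis
    unfolding is_t_number_def is_p_number_def is_least_size_def
    using t_family_omega1[of j] t_families_subset_p_families[of k] k by blast
qed

end
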